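(* Let $P, Q$ be nonzero real numbers with $\Delta := P^2 - 4Q > 0$, and let $(U_n)_{n\in\mathbb{Z}}$ and $\beta$ be as in the context. For any positive integer $r$, $$\sum_{n = 0}^{+\infty} \frac{\beta^{2^r n + 2^{r - 1}}}{U_{2^r n + 2^{r - 1}}} = \sum_{n = 1}^{+\infty} \frac{Q^{2^{r - 1} n}}{U_{2^r n}},$$ both series being convergent.
   Context: $P, Q$ are fixed nonzero real numbers with $\Delta := P^2 - 4Q > 0$. $\alpha$ and $\beta$ denote the two real roots of $X^2 - PX + Q = 0$, labelled so that $|\alpha| > |\beta|$ (the absolute values are distinct because $P \neq 0$ and $\Delta > 0$). The Lucas sequence of the first kind $(U_n)_{n \in \mathbb{Z}}$ is defined by $U_0 = 0$, $U_1 = 1$ and $U_{n+2} = P U_{n+1} - Q U_n$ for all $n \in \mathbb{Z}$; equivalently $U_n = \frac{\alpha^n - \beta^n}{\alpha - \beta}$. *)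

theory Defs
  imports Complex_Main
begin

text \<open>For \<open>Q \<noteq> 0\<close> the recurrence can also be run backwards, so the three clauses determine
  \<open>U\<close> uniquely on all integers; see \<open>is_lucas_U_iff\<close> below for the closed form.\<close>

definition is_lucas_U :: "real \<Rightarrow> real \<Rightarrow> (int \<Rightarrow> real) \<Rightarrow> bool" where
  "is_lucas_U P Q U \<longleftrightarrow>
     U 0 = 0 \<and> U 1 = 1 \<and> (\<forall>n. U (n + 2) = P * U (n + 1) - Q * U n)"

definition lucas_roots :: "real \<Rightarrow> real \<Rightarrow> real \<Rightarrow> real \<Rightarrow> bool" where
  "lucas_roots P Q \<alpha> \<beta> \<longleftrightarrow> {x. x\<^sup>2 - P * x + Q = 0} = {\<alpha>, \<beta>} \<and> \<bar>\<alpha>\<bar> > \<bar>\<beta>\<bar>"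

lemma is_lucas_U_unique:
  assumes "Q \<noteq> 0" "is_lucas_U P Q U" "is_lucas_U P Q V"
  shows "U = V"
proof -
  have rU: "U (n + 2) = P * U (n + 1) - Q * U n" and rV: "V (n + 2) = P * V (n + 1) - Q * V n" for n
    using assms by (auto simp: is_lucas_U_def)
  have "U n = V n \<and> U (n + 1) = V (n + 1)" for n
  proof (induction n rule: int_induct[where k = 0])
    case base
    then show ?case using assms by (simp add: is_lucas_U_def)
  next
    case (step1 i)
    then show ?case using rU[of i] rV[of i] by (simp add: add.assoc)
  next
    case (step2 i)
    have "Q * U (i - 1) = Q * V (i - 1)"
      using step2 rU[of "i - 1"] rV[of "i - 1"] by (simp add: add.commute)
    then have "U (i - 1) = V (i - 1)" using assms(1) by simp
    then show ?case using step2 by simp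
  qed
  then show ?thesis by auto
qed

lemma is_lucas_U_iff:
  assumes "Q \<noteq> 0" "lucas_roots P Q \<alpha> \<beta>"
  shows "is_lucas_U P Q U \<longleftrightarrow> U = (\<lambda>n. (\<alpha> powi n - \<beta> powi n) / (\<alpha> - \<beta>))"
proof -
  let ?V = "\<lambda>n. (\<alpha> powi n - \<beta> powi n) / (\<alpha> - \<beta>)"
  have r: "\<alpha>\<^sup>2 = P * \<alpha> - Q" "\<beta>\<^sup>2 = P * \<beta> - Q" and ne: "\<alpha> \<noteq> \<beta>"
    using assms(2) by (auto simp: lucas_roots_def set_eq_iff algebra_simps)
  have nz: "\<alpha> \<noteq> 0" "\<beta> \<noteq> 0" using r assms(1) by auto
  have p: "x powi (n + 2) = P * x powi (n + 1) - Q * x powi n"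
    if "x \<noteq> 0" "x\<^sup>2 = P * x - Q" for x :: real and n
  proof -
    have "x powi (n + 2) = x powi n * x\<^sup>2"
      using that(1) by (simp add: power_int_add)
    also have "\<dots> = x powi n * (P * x - Q)" by (simp only: that(2))
    finally show ?thesis
      using that(1) by (simp add: power_int_add algebra_simps)
  qed
  have "is_lucas_U P Q ?V"
    using ne unfolding is_lucas_U_def
    by (auto simp: p[OF nz(1) r(1)] p[OF nz(2) r(2)] diff_divide_distrib right_diff_distrib)
  then show ?thesis using is_lucas_U_unique[OF assms(1)] by blast
qed

lemma ex_lucas_roots:
  assumes "P \<noteq> 0" "P\<^sup>2 - 4 * Q > 0"
  shows "\<exists>\<alpha> \<beta>. lucas_roots P Q \<alpha> \<beta>"
proof -
  define s where "s = sqrt (P\<^sup>2 - 4 * Q)"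
  have s: "s > 0" "s\<^sup>2 = P\<^sup>2 - 4 * Q" using assms(2) by (auto simp: s_def)
  have "x\<^sup>2 - P * x + Q = (x - (P + s) / 2) * (x - (P - s) / 2)" for x
    using s(2) by (simp add: field_simps power2_eq_square)
  then have *: "{x. x\<^sup>2 - P * x + Q = 0} = {(P + s) / 2, (P - s) / 2}" by auto
  show ?thesis
  proof (cases "P > 0")
    case True
    then have "lucas_roots P Q ((P + s) / 2) ((P - s) / 2)"
      using * s(1) by (auto simp: lucas_roots_def)
    then show ?thesis by blast
  next
    case False
    then have "lucas_roots P Q ((P - s) / 2) ((P + s) / 2)"
      using * s(1) assms(1) by (auto simp: lucas_roots_def)
    then show ?thesis by blast
  qed
qed

end

theory Submission
  imports Defs "HOL-Analysis.Infinite_Sum"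
begin

text \<open>
  Put \<open>q = (\<beta> / \<alpha>) ^ 2 ^ (r - 1)\<close>, so that \<open>\<bar>q\<bar> < 1\<close>. By the Binet formula, the terms
  are \<open>\<alpha> - \<beta>\<close> times \<open>q ^ (2 * n + 1) / (1 - q ^ (2 * n + 1))\<close> on the left and
  \<open>\<alpha> - \<beta>\<close> times \<open>q ^ k / (1 - q ^ (2 * k))\<close> on the right. Expanding either one as a geometric
  series gives the absolutely convergent double series of \<open>q ^ ((2 * n + 1) * k)\<close>.
\<close>

text \<open>Since \<open>n + j \<le> (2 * n + 1) * (j + 1)\<close> and
  \<open>\<bar>q\<bar> < 1\<close>, the family is dominated by a product of two convergent geometric
  series.\<close>

lemma summable_on_power_odd_mult:
  fixes q :: real
  assumes "\<bar>q\<bar> < 1"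
  shows "(\<lambda>(n::nat, j::nat). q ^ ((2 * n + 1) * (j + 1))) summable_on UNIV \<times> UNIV"
proof -
  have g: "(\<lambda>n::nat. \<bar>q\<bar> ^ n) summable_on UNIV"
    using assms by (intro norm_summable_imp_summable_on) (auto intro: summable_geometric)
  have dominating: "(\<lambda>(n::nat, j::nat). \<bar>q\<bar> ^ n * \<bar>q\<bar> ^ j) summable_on UNIV \<times> UNIV"
    using g by (intro summable_on_SigmaI[where g = "\<lambda>n. \<bar>q\<bar> ^ n * (\<Sum>\<^sub>\<infinity>j. \<bar>q\<bar> ^ j)"])
      (auto intro!: has_sum_cmult_right summable_on_cmult_left)
  have bound: "norm (q ^ ((2 * n + 1) * (j + 1))) \<le> \<bar>q\<bar> ^ n * \<bar>q\<bar> ^ j" for n j :: nat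
    unfolding power_add[symmetric] real_norm_def power_abs
    using assms by (intro power_decreasing) auto
  show ?thesis
    by (rule abs_summable_summable, rule abs_summable_on_comparison_test'[OF dominating])
      (simp only: case_prod_unfold bound)
qed

lemma has_sum_geometric_Suc:
  fixes x :: real
  assumes "\<bar>x\<bar> < 1"
  shows "((\<lambda>j. x ^ (j + 1)) has_sum x / (1 - x)) UNIV"
proof -
  have "(\<lambda>j. x ^ (j + 1)) sums (x / (1 - x))"
    using sums_mult[OF geometric_sums, of x x] assms by simp
  moreover have "summable (\<lambda>j. norm (x ^ (j + 1)))"
    using assms by (simp add: abs_mult power_abs summable_mult summable_geometric)
  ultimately show ?thesis by (simp add: norm_summable_imp_has_sum)
qed

text \<open>A geometric series with first term \<open>x\<close> and ratio \<open>x\<^sup>2\<close>;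
  absolute convergence turns \<open>sums\<close> into the unordered \<open>has_sum\<close> that
  Fubini-type rules require.\<close>

lemma has_sum_power_odd:
  fixes x :: real
  assumes "\<bar>x\<bar> < 1"
  shows "((\<lambda>n. x ^ (2 * n + 1)) has_sum x / (1 - x ^ 2)) UNIV"
proof -
  have x2: "\<bar>x\<^sup>2\<bar> < 1" using assms by (simp add: abs_square_less_1)
  have "(\<lambda>n. x ^ (2 * n + 1)) sums (x / (1 - x ^ 2))"
    using sums_mult[OF geometric_sums, of "x\<^sup>2" x] x2 by (simp add: power_mult)
  moreover have "summable (\<lambda>n. norm (x ^ (2 * n + 1)))"
    using x2 by (simp add: abs_mult power_abs power_mult summable_mult summable_geometric)
  ultimately show ?thesis by (simp add: norm_summable_imp_has_sum)
qed

text \<open>Both series are iterated sums of one summable double family: summing over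
  \<open>j\<close> first gives the first, summing over \<open>n\<close> first gives the second, so
  they share the value \<open>S\<close>.\<close>

lemma lambert_odd_sums:
  fixes q :: real
  assumes "\<bar>q\<bar> < 1"
  obtains S where "(\<lambda>n. q ^ (2 * n + 1) / (1 - q ^ (2 * n + 1))) sums S"
    and "(\<lambda>j. q ^ Suc j / (1 - q ^ (2 * Suc j))) sums S"
proof -
  define f where "f = (\<lambda>(n::nat, j::nat). q ^ ((2 * n + 1) * (j + 1)))"
  obtain S where S: "(f has_sum S) (UNIV \<times> UNIV)"
    using summable_on_power_odd_mult[OF assms] unfolding f_def summable_on_def by blast
  have small: "\<bar>q ^ Suc k\<bar> < 1" for k
    using assms unfolding power_abs by (subst power_less_one_iff) auto
  have rows: "((\<lambda>j. f (n, j)) has_sum q ^ (2 * n + 1) / (1 - q ^ (2 * n + 1))) UNIV" for n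
    using has_sum_geometric_Suc[of "q ^ (2 * n + 1)"] small[of "2 * n"]
    by (simp only: f_def prod.case power_mult) simp
  have cols: "((\<lambda>n. f (n, j)) has_sum q ^ Suc j / (1 - q ^ (2 * Suc j))) UNIV" for j
    using has_sum_power_odd[of "q ^ Suc j"] small[of j]
    unfolding f_def prod.case power_mult[symmetric] by (simp add: mult.commute)
  \<comment> \<open>\<open>has_sum_Sigma'\<close> sums over the second coordinate first, so the
    indices are swapped to make \<open>n\<close> the inner one.\<close>
  have S': "((\<lambda>(j, n). f (n, j)) has_sum S) (UNIV \<times> UNIV)"
    using S by (subst has_sum_swap) (simp add: case_prod_unfold)
  have "((\<lambda>n. q ^ (2 * n + 1) / (1 - q ^ (2 * n + 1))) has_sum S) UNIV"
    by (rule has_sum_Sigma'[OF S rows])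
  moreover have "((\<lambda>j. q ^ Suc j / (1 - q ^ (2 * Suc j))) has_sum S) UNIV"
    by (rule has_sum_Sigma'[OF S']) (simp only: prod.case cols)
  ultimately show thesis by (intro that has_sum_imp_sums)
qed

theorem theorem3p6:
  fixes P Q \<alpha> \<beta> :: real and U :: "int \<Rightarrow> real" and r :: nat
  assumes "P \<noteq> 0" and "Q \<noteq> 0" and "P\<^sup>2 - 4 * Q > 0"
    and "lucas_roots P Q \<alpha> \<beta>"
    and "is_lucas_U P Q U"
    and "r \<ge> 1"
  shows "summable (\<lambda>n::nat. \<beta> ^ (2 ^ r * n + 2 ^ (r - 1)) / U (int (2 ^ r * n + 2 ^ (r - 1))))
    \<and> summable (\<lambda>n::nat. Q ^ (2 ^ (r - 1) * Suc n) / U (int (2 ^ r * Suc n)))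
    \<and> (\<Sum>n::nat. \<beta> ^ (2 ^ r * n + 2 ^ (r - 1)) / U (int (2 ^ r * n + 2 ^ (r - 1))))
        = (\<Sum>n::nat. Q ^ (2 ^ (r - 1) * Suc n) / U (int (2 ^ r * Suc n)))"
proof -
  define m :: nat where "m = 2 ^ (r - 1)"
  have m: "2 ^ r = 2 * m" "m > 0"
    using \<open>r \<ge> 1\<close> by (simp_all add: m_def power_Suc[symmetric] del: power_Suc)
  have abs: "\<bar>\<beta>\<bar> < \<bar>\<alpha>\<bar>" and "\<alpha>\<^sup>2 - P * \<alpha> + Q = 0" "\<beta>\<^sup>2 - P * \<beta> + Q = 0"
    using assms(4) by (auto simp: lucas_roots_def set_eq_iff)
  \<comment> \<open>The difference of the two root equations, factored. As the roots differ in
    absolute value, the first factor is nonzero, and Vieta's formulas follow.\<close>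
  then have "(\<alpha> - \<beta>) * (\<alpha> + \<beta> - P) = 0" by algebra
  with abs have "P = \<alpha> + \<beta>" by auto
  with \<open>\<alpha>\<^sup>2 - P * \<alpha> + Q = 0\<close> have Q: "Q = \<alpha> * \<beta>"
    by (simp add: algebra_simps power2_eq_square)
  have "\<alpha> \<noteq> 0" using abs by auto
  have U: "U (int k) = (\<alpha> ^ k - \<beta> ^ k) / (\<alpha> - \<beta>)" for k
    using is_lucas_U_iff[OF assms(2,4)] assms(5) by simp
  define q where "q = (\<beta> / \<alpha>) ^ m"
  have "\<bar>\<beta> / \<alpha>\<bar> < 1" using abs by (simp add: abs_divide)
  then have "\<bar>q\<bar> < 1"
    unfolding q_def power_abs using m(2) by (intro power_less_one_iff[THEN iffD2]) auto
  then obtain S where S: "(\<lambda>n. q ^ (2 * n + 1) / (1 - q ^ (2 * n + 1))) sums S"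
      "(\<lambda>j. q ^ Suc j / (1 - q ^ (2 * Suc j))) sums S"
    by (rule lambert_odd_sums)
  \<comment> \<open>Numerator and denominator are divided by \<open>\<alpha> ^ k\<close>. At
    \<open>k = 0\<close> both sides are 0, because division by zero yields 0.\<close>
  have binet_left: "\<beta> ^ k / U (int k) = (\<alpha> - \<beta>) * ((\<beta> / \<alpha>) ^ k / (1 - (\<beta> / \<alpha>) ^ k))" for k
    using \<open>\<alpha> \<noteq> 0\<close> by (simp add: U power_divide diff_divide_eq_iff)
  have left: "\<beta> ^ (2 * m * n + m) / U (int (2 * m * n + m))
      = (\<alpha> - \<beta>) * (q ^ (2 * n + 1) / (1 - q ^ (2 * n + 1)))" for n
  proof -
    have "2 * m * n + m = m * (2 * n + 1)" by (simp add: algebra_simps)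
    then show ?thesis unfolding q_def power_mult[symmetric] by (simp only: binet_left)
  qed
  \<comment> \<open>Here the division is by \<open>\<alpha> ^ (2 * k)\<close>, and
    \<open>Q = \<alpha> * \<beta>\<close> turns the numerator into
    \<open>(\<beta> / \<alpha>) ^ k\<close>.\<close>
  have "Q ^ k / U (int (2 * k)) = (\<alpha> - \<beta>) * ((\<beta> / \<alpha>) ^ k / (1 - (\<beta> / \<alpha>) ^ (2 * k)))" for k
  proof -
    have num: "(\<beta> / \<alpha>) ^ k = Q ^ k / \<alpha> ^ (2 * k)"
      using \<open>\<alpha> \<noteq> 0\<close> by (simp add: Q power_divide power_mult_distrib power_mult power2_eq_square
          power_even_eq)
    have den: "1 - (\<beta> / \<alpha>) ^ (2 * k) = (\<alpha> ^ (2 * k) - \<beta> ^ (2 * k)) / \<alpha> ^ (2 * k)"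
      using \<open>\<alpha> \<noteq> 0\<close> by (simp add: power_divide diff_divide_distrib)
    show ?thesis
      unfolding U num den using \<open>\<alpha> \<noteq> 0\<close> by simp
  qed
  from this[of "m * Suc _"] have right: "Q ^ (m * Suc n) / U (int (2 * m * Suc n))
      = (\<alpha> - \<beta>) * (q ^ Suc n / (1 - q ^ (2 * Suc n)))" for n
    unfolding q_def power_mult[symmetric] by (simp only: mult.assoc mult.left_commute)
  show ?thesis
    \<comment> \<open>Both sides are now \<open>\<alpha> - \<beta>\<close> times a series with sum
      \<open>S\<close>.\<close>
    unfolding m(1) m_def[symmetric] left right
    by (intro conjI sums_summable[OF sums_mult[OF S(1)]] sums_summable[OF sums_mult[OF S(2)]])
      (simp only: sums_unique[OF sums_mult[OF S(1)], symmetric]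
        sums_unique[OF sums_mult[OF S(2)], symmetric])
qed

end
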